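(* For $m$ odd and $A\subseteq\{0,1,\dots,m-1\}$ which is neither empty nor the full set, \[\mathsf{UPP}(\mathrm{mod}_m^A\circ\mathsf{XOR})=\Omega(n/m^2)-2\log m.\]
   Context: For positive integer $m<n$ and $A\subseteq\{0,\dots,m-1\}$, $\mathrm{mod}_m^A:\{0,1\}^n\to\{-1,1\}$ is $-1$ if $\sum_ix_i\equiv a\pmod m$ for some $a\in A$, and $1$ otherwise. $(\mathrm{mod}_m^A\circ\mathsf{XOR})(x,y)=\mathrm{mod}_m^A(x\oplus y)$, Alice holding $x\in\{0,1\}^n$, Bob $y\in\{0,1\}^n$. $\mathsf{UPP}(G)=\min_{\epsilon>0}R_\epsilon(G)$, where $R_\epsilon(G)$ is the minimum worst-case communication of a private-coin protocol correct with probability $\ge1/2+\epsilon$ on every input. The $\Omega$ hides a universal positive constant. *)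

theory Defs
  imports "HOL-Probability.Probability" "HOL-Number_Theory.Cong"
begin

text \<open>Deterministic two-party protocol trees: at an inner node the named party
  announces one bit, computed from what that party holds, and the play moves to the
  first subtree if the bit is true. The output is a function of the transcript.\<close>

datatype ('a, 'b, 'o) protocol =
    Output 'o
  | Alice "'a \<Rightarrow> bool" "('a, 'b, 'o) protocol" "('a, 'b, 'o) protocol"
  | Bob "'b \<Rightarrow> bool" "('a, 'b, 'o) protocol" "('a, 'b, 'o) protocol"

primrec run :: "('a, 'b, 'o) protocol \<Rightarrow> 'a \<Rightarrow> 'b \<Rightarrow> 'o" where
  "run (Output z) a b = z"
| "run (Alice f P Q) a b = (if f a then run P a b else run Q a b)"
| "run (Bob g P Q) a b = (if g b then run P a b else run Q a b)"

primrec cost :: "('a, 'b, 'o) protocol \<Rightarrow> nat" where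
  "cost (Output z) = 0"
| "cost (Alice f P Q) = Suc (max (cost P) (cost Q))"
| "cost (Bob g P Q) = Suc (max (cost P) (cost Q))"

text \<open>In a private-coin protocol Alice holds her input and her own random string
  (coded as a natural number, with arbitrary distribution \<open>\<mu>\<close>), and Bob holds his
  input and an independent random string with distribution \<open>\<nu>\<close>. The predicate says
  that on every input in \<open>X \<times> Y\<close> the output equals \<open>G x y\<close> with probability at
  least \<open>1/2 + \<epsilon>\<close>.\<close>

definition computes_with_advantage ::
  "'x set \<Rightarrow> 'y set \<Rightarrow> ('x \<Rightarrow> 'y \<Rightarrow> 'o) \<Rightarrow> real \<Rightarrow>
     ('x \<times> nat, 'y \<times> nat, 'o) protocol \<Rightarrow> nat pmf \<Rightarrow> nat pmf \<Rightarrow> bool" where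
  "computes_with_advantage X Y G \<epsilon> P \<mu> \<nu> \<longleftrightarrow>
     (\<forall>x\<in>X. \<forall>y\<in>Y.
        measure_pmf.prob (pair_pmf \<mu> \<nu>) {(r, s). run P (x, r) (y, s) = G x y} \<ge> 1/2 + \<epsilon>)"

text \<open>The value is \<open>\<infinity>\<close> when no protocol achieves advantage \<open>\<epsilon>\<close>
  (for instance if \<open>\<epsilon> > 1/2\<close>). Infima of nonempty sets of extended naturals are
  attained, so the infima below are minima.\<close>

definition rand_cc :: "real \<Rightarrow> 'x set \<Rightarrow> 'y set \<Rightarrow> ('x \<Rightarrow> 'y \<Rightarrow> 'o) \<Rightarrow> enat" where
  "rand_cc \<epsilon> X Y G =
     Inf {enat (cost P) | P \<mu> \<nu>. computes_with_advantage X Y G \<epsilon> P \<mu> \<nu>}"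

definition UPP :: "'x set \<Rightarrow> 'y set \<Rightarrow> ('x \<Rightarrow> 'y \<Rightarrow> 'o) \<Rightarrow> enat" where
  "UPP X Y G = (INF \<epsilon>\<in>{0<..}. rand_cc \<epsilon> X Y G)"

definition cube :: "nat \<Rightarrow> bool list set" where
  "cube n = {x. length x = n}"

definition mod_fun :: "nat \<Rightarrow> nat set \<Rightarrow> bool list \<Rightarrow> int" where
  "mod_fun m A x = (if \<exists>a\<in>A. [(\<Sum>i<length x. of_bool (x ! i)) = a] (mod m) then -1 else 1)"

definition xor_bits :: "bool list \<Rightarrow> bool list \<Rightarrow> bool list" (infixl "\<oplus>" 65) where
  "x \<oplus> y = map2 (\<noteq>) x y"

definition compose_xor :: "(bool list \<Rightarrow> 'o) \<Rightarrow> bool list \<Rightarrow> bool list \<Rightarrow> 'o" where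
  "compose_xor f x y = f (x \<oplus> y)"

end

theory Submission
  imports Defs "Jordan_Normal_Form.Spectral_Radius"
begin

text \<open>
  A protocol of cost \<open>c\<close> with positive advantage realises the sign pattern of the communication
  matrix by inner products of vectors of dimension \<open>d = 2\<^sup>c\<close>, so it suffices to bound the sign rank
  from below by Forster's method.

  Forster's theorem is needed only approximately. Normalise the vectors of one side after a linear
  map \<open>T\<close> that nearly minimises \<open>\<Sum>x. ln \<bar>T x\<bar>\<^sup>2 - q ln (det T)\<^sup>2\<close>, where \<open>q\<close> is the number of
  vectors divided by \<open>d\<close>. Once the vectors are split into \<open>q\<close> bases (after a small perturbation),
  the potential is bounded below, because a determinant is at most \<open>d!\<close> times the product of its
  column lengths. Comparing \<open>T\<close> with its stretching by \<open>\<surd>2\<close> along a unit vector \<open>v\<close> shows that the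
  normalised vectors satisfy \<open>\<Sum>u. (u \<bullet> v)\<^sup>2 \<ge> q / 2\<close>. No minimiser has to exist.

  The method is applied to the matrix \<open>h (\<bar>x \<oplus> y\<bar> mod m)\<close>, where \<open>h\<close> is the sign function of \<open>A\<close>
  reweighted to have mean 0. By Fourier inversion modulo \<open>m\<close> it is a combination of the
  matrices \<open>z\<^bsup>\<bar>x \<oplus> y\<bar>\<^esup>\<close> over the roots of unity \<open>z \<noteq> 1\<close> of order dividing \<open>m\<close>; these are tensor
  powers with operator norm \<open>max \<bar>1 \<plusminus> z\<bar>\<^sup>n \<le> 2\<^sup>n exp (- n / (8 m\<^sup>2))\<close>, where \<open>m\<close> odd rules out
  \<open>z = -1\<close>.
\<close>

hide_const (open) Determinants.det
no_notation Inner_Product.real_inner_class.inner (infix "\<bullet>" 70)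
unbundle no vec_syntax

subsection \<open>Near-isotropic position\<close>

text \<open>The matrix determinant lemma: both products of the block matrices \<open>F\<close> and
  \<open>G\<close> are block lower triangular. The nontrivial diagonal block is 1 + V U in
  \<open>F * G\<close> and 1 + U V in \<open>G * F\<close>, and the two products have the same
  determinant.\<close>

lemma det_one_plus_rank_one:
  fixes u v :: "real vec"
  assumes u: "u \<in> carrier_vec d" and v: "v \<in> carrier_vec d"
  shows "det (mat d d (\<lambda>(i, j). of_bool (i = j) + u $ i * v $ j)) = 1 + v \<bullet> u"
proof -
  define U where "U = mat d 1 (\<lambda>(i, j). u $ i)"
  define V where "V = mat 1 d (\<lambda>(i, j). v $ j)"
  have U: "U \<in> carrier_mat d 1" and V: "V \<in> carrier_mat 1 d"
    by (auto simp: U_def V_def)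
  define F where "F = four_block_mat (1\<^sub>m d) (- U) V (1\<^sub>m 1)"
  define G where "G = four_block_mat (1\<^sub>m d) U (0\<^sub>m 1 d) (1\<^sub>m 1)"
  have F: "F \<in> carrier_mat (d + 1) (d + 1)" and G: "G \<in> carrier_mat (d + 1) (d + 1)"
    unfolding F_def G_def using U V by auto
  have "F * G = four_block_mat (1\<^sub>m d * 1\<^sub>m d + - U * 0\<^sub>m 1 d) (1\<^sub>m d * U + - U * 1\<^sub>m 1)
      (V * 1\<^sub>m d + 1\<^sub>m 1 * 0\<^sub>m 1 d) (V * U + 1\<^sub>m 1 * 1\<^sub>m 1)"
    unfolding F_def G_def by (rule mult_four_block_mat) (use U V in auto)
  also have "\<dots> = four_block_mat (1\<^sub>m d) (0\<^sub>m d 1) V (V * U + 1\<^sub>m 1)"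
    using U V by (intro cong_four_block_mat) auto
  finally have FG: "det (F * G) = det (V * U + 1\<^sub>m 1)"
    using det_four_block_mat_upper_right_zero[of "1\<^sub>m d :: real mat" d "0\<^sub>m d 1" 1 V "V * U + 1\<^sub>m 1"] U V
    by auto
  have "G * F = four_block_mat (1\<^sub>m d * 1\<^sub>m d + U * V) (1\<^sub>m d * - U + U * 1\<^sub>m 1)
      (0\<^sub>m 1 d * 1\<^sub>m d + 1\<^sub>m 1 * V) (0\<^sub>m 1 d * - U + 1\<^sub>m 1 * 1\<^sub>m 1)"
    unfolding F_def G_def by (rule mult_four_block_mat) (use U V in auto)
  also have "\<dots> = four_block_mat (1\<^sub>m d + U * V) (0\<^sub>m d 1) V (1\<^sub>m 1)"
    using U V by (intro cong_four_block_mat) auto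
  finally have GF: "det (G * F) = det (1\<^sub>m d + U * V)"
    using det_four_block_mat_upper_right_zero[of "1\<^sub>m d + U * V" d "0\<^sub>m d 1" 1 V "1\<^sub>m 1"] U V
    by auto
  have "mat d d (\<lambda>(i, j). of_bool (i = j) + u $ i * v $ j) = 1\<^sub>m d + U * V"
    by (rule eq_matI) (auto simp: U_def V_def scalar_prod_def)
  moreover have "V * U + 1\<^sub>m 1 = mat 1 1 (\<lambda>_. 1 + v \<bullet> u)"
    by (rule eq_matI) (use u v in \<open>auto simp: U_def V_def scalar_prod_def\<close>)
  moreover have "det (mat 1 1 (\<lambda>_. 1 + v \<bullet> u)) = 1 + v \<bullet> u"
    by (subst det_single) auto
  ultimately show ?thesis
    using FG GF det_mult[OF F G] det_mult[OF G F] by (simp add: mult.commute)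
qed

text \<open>A crude Hadamard inequality: each of the d! Leibniz terms is at most the product of the
  column lengths. The lost factor d! only shifts the lower bound of a potential by a
  constant.\<close>

lemma abs_det_le_prod_col_norms:
  fixes A :: "real mat"
  assumes A: "A \<in> carrier_mat d d"
  shows "\<bar>det A\<bar> \<le> fact d * (\<Prod>j<d. sqrt (col A j \<bullet> col A j))"
proof -
  have entry: "\<bar>A $$ (i, j)\<bar> \<le> sqrt (col A j \<bullet> col A j)" if "i < d" "j < d" for i j
  proof -
    have "(A $$ (i, j))\<^sup>2 \<le> (\<Sum>k = 0..<d. (A $$ (k, j))\<^sup>2)"
      using that by (intro member_le_sum) auto
    also have "\<dots> = col A j \<bullet> col A j"
      using A that by (auto simp: scalar_prod_def power2_eq_square)
    finally show ?thesis
      by (metis real_sqrt_abs real_sqrt_le_mono)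
  qed
  have "\<bar>det A\<bar> \<le> (\<Sum>p | p permutes {0..<d}. \<bar>signof p * (\<Prod>i = 0..<d. A $$ (i, p i))\<bar>)"
    unfolding det_def'[OF A] by (rule sum_abs)
  also have "\<dots> \<le> (\<Sum>p | p permutes {0..<d}. \<Prod>j<d. sqrt (col A j \<bullet> col A j))"
  proof (rule sum_mono)
    fix p assume "p \<in> {p. p permutes {0..<d}}"
    then have p: "p permutes {0..<d}" by simp
    have "\<bar>signof p * (\<Prod>i = 0..<d. A $$ (i, p i))\<bar> = (\<Prod>i = 0..<d. \<bar>A $$ (i, p i)\<bar>)"
      by (simp add: abs_mult abs_prod sign_def)
    also have "\<dots> \<le> (\<Prod>i = 0..<d. sqrt (col A (p i) \<bullet> col A (p i)))"
      using permutes_in_image[OF p] entry by (intro prod_mono) auto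
    also have "\<dots> = (\<Prod>j = 0..<d. sqrt (col A j \<bullet> col A j))"
      using prod.permute[OF p, of "\<lambda>j. sqrt (col A j \<bullet> col A j)"] by (simp add: o_def)
    finally show "\<bar>signof p * (\<Prod>i = 0..<d. A $$ (i, p i))\<bar> \<le> (\<Prod>j<d. sqrt (col A j \<bullet> col A j))"
      by (simp add: lessThan_atLeast0)
  qed
  also have "\<dots> = fact d * (\<Prod>j<d. sqrt (col A j \<bullet> col A j))"
    by (simp add: card_permutations[of _ d])
  finally show ?thesis .
qed

lemma scalar_prod_self_nonneg: "(v :: real vec) \<bullet> v \<ge> 0"
  by (simp add: scalar_prod_def sum_nonneg)

text \<open>Since (1 + t)^2 = 2, the map \<open>B\<close> doubles squared lengths along
  \<open>v\<close> and fixes the orthogonal complement of \<open>v\<close>.\<close>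

lemma scalar_prod_self_stretch:
  fixes y v :: "real vec"
  assumes y: "y \<in> carrier_vec d" and v: "v \<in> carrier_vec d" "v \<bullet> v = 1"
    and t: "2 * t + t\<^sup>2 = 1"
  defines "B \<equiv> mat d d (\<lambda>(i, j). of_bool (i = j) + (t \<cdot>\<^sub>v v) $ i * v $ j)"
  shows "(B *\<^sub>v y) \<bullet> (B *\<^sub>v y) = y \<bullet> y + (y \<bullet> v)\<^sup>2"
proof -
  have "B *\<^sub>v y = y + (t * (y \<bullet> v)) \<cdot>\<^sub>v v"
  proof (rule eq_vecI)
    fix i assume "i < dim_vec (y + (t * (y \<bullet> v)) \<cdot>\<^sub>v v)"
    then have i: "i < d" using v y by auto
    have "(B *\<^sub>v y) $ i = (\<Sum>j = 0..<d. (of_bool (i = j) + t * v $ i * v $ j) * y $ j)"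
      using i y v by (auto simp: B_def scalar_prod_def)
    also have "\<dots> = (\<Sum>j = 0..<d. if i = j then y $ j else 0) + t * v $ i * (\<Sum>j = 0..<d. y $ j * v $ j)"
      unfolding sum_distrib_left sum.distrib[symmetric]
      by (rule sum.cong) (auto simp: algebra_simps)
    also have "\<dots> = (y + (t * (y \<bullet> v)) \<cdot>\<^sub>v v) $ i"
      using i y v by (auto simp: scalar_prod_def)
    finally show "(B *\<^sub>v y) $ i = (y + (t * (y \<bullet> v)) \<cdot>\<^sub>v v) $ i" .
  qed (use y v in \<open>auto simp: B_def\<close>)
  moreover define s where "s = y \<bullet> v"
  moreover have "(y + (t * s) \<cdot>\<^sub>v v) \<bullet> (y + (t * s) \<cdot>\<^sub>v v)
      = y \<bullet> y + 2 * (t * s) * s + (t * s)\<^sup>2 * (v \<bullet> v)"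
    using y v unfolding s_def
    by (simp add: scalar_prod_add_distrib[of _ d] add_scalar_prod_distrib[of _ d] comm_scalar_prod[of v d y]
        algebra_simps power2_eq_square)
  moreover have "2 * (t * s) * s + (t * s)\<^sup>2 = (2 * t + t\<^sup>2) * s\<^sup>2"
    by (simp add: algebra_simps power2_eq_square)
  ultimately show ?thesis
    using v t by (simp add: add.assoc)
qed

lemma col_mult_mat_eq:
  assumes "A \<in> carrier_mat n k" "B \<in> carrier_mat k m" "j < m"
  shows "col (A * B) j = A *\<^sub>v col B j"
  using assms by (intro eq_vecI) auto

text \<open>Over an orthonormal basis of directions \<open>v\<close> the sums add up to the number
  \<open>q * d\<close> of vectors, so exact isotropy would give \<open>q\<close> in each direction.
  One finite step from a near minimiser still yields half of that.\<close>

lemma ex_near_isotropic_position: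
  fixes a :: "nat \<times> nat \<Rightarrow> real vec"
  assumes q: "q > 0"
    and a: "\<And>b j. b < q \<Longrightarrow> j < d \<Longrightarrow> a (b, j) \<in> carrier_vec d"
    and indep: "\<And>b. b < q \<Longrightarrow> det (mat d d (\<lambda>(i, j). a (b, j) $ i)) \<noteq> 0"
  obtains A where "A \<in> carrier_mat d d" "det A \<noteq> 0"
    "\<And>x. x \<in> {..<q} \<times> {..<d} \<Longrightarrow> (A *\<^sub>v a x) \<bullet> (A *\<^sub>v a x) > 0"
    "\<And>v. v \<in> carrier_vec d \<Longrightarrow> v \<bullet> v = 1 \<Longrightarrow>
       real q / 2 \<le> (\<Sum>x\<in>{..<q} \<times> {..<d}. ((A *\<^sub>v a x) \<bullet> v)\<^sup>2 / ((A *\<^sub>v a x) \<bullet> (A *\<^sub>v a x)))"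
proof -
  define X where "X = {..<q} \<times> {..<d}"
  define GL where "GL = {A \<in> carrier_mat d d. det A \<noteq> (0 :: real)}"
  define Xb where "Xb = (\<lambda>b. mat d d (\<lambda>(i, j). a (b, j) $ i))"
  define sq where "sq = (\<lambda>A x. (A *\<^sub>v a x) \<bullet> (A *\<^sub>v a x))"
  \<comment> \<open>The weight \<open>q\<close> makes \<open>\<Phi>\<close> invariant under scaling
    of \<open>A\<close>: a factor s adds ln s^2 to each of the \<open>q * d\<close> summands and d
    ln s^2 to the logarithm of the squared determinant.\<close>
  define \<Phi> where "\<Phi> = (\<lambda>A. (\<Sum>x\<in>X. ln (sq A x)) - q * ln ((det A)\<^sup>2))"
  have finX: "finite X" by (simp add: X_def)
  have a': "a x \<in> carrier_vec d" if "x \<in> X" for x using that a by (auto simp: X_def)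
  have Xb: "Xb b \<in> carrier_mat d d" for b by (simp add: Xb_def)
  have block: "\<bar>det A\<bar> * \<bar>det (Xb b)\<bar> \<le> fact d * (\<Prod>j<d. sqrt (sq A (b, j)))"
    if A: "A \<in> GL" and b: "b < q" for A b
  proof -
    have Ac: "A \<in> carrier_mat d d" using A by (simp add: GL_def)
    have "col (A * Xb b) j = A *\<^sub>v a (b, j)" if "j < d" for j
    proof -
      have "col (Xb b) j = a (b, j)" using a[OF b that] that by (auto simp: Xb_def)
      then show ?thesis using col_mult_mat_eq[OF Ac Xb that] by simp
    qed
    then show ?thesis
      using abs_det_le_prod_col_norms[of "A * Xb b" d] Ac Xb det_mult[OF Ac Xb]
      by (simp add: abs_mult sq_def)
  qed
  have pos: "sq A x > 0" if A: "A \<in> GL" and x: "x \<in> X" for A x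
  proof -
    obtain b j where x_eq: "x = (b, j)" and b: "b < q" and j: "j < d" using x by (auto simp: X_def)
    have "0 < \<bar>det A\<bar> * \<bar>det (Xb b)\<bar>" using A indep[OF b] by (simp add: GL_def Xb_def)
    also note block[OF A b]
    finally have "(\<Prod>j<d. sqrt (sq A (b, j))) \<noteq> 0" by (metis less_irrefl mult_zero_right)
    then have "sqrt (sq A x) \<noteq> 0" using j by (auto simp: x_eq)
    then show ?thesis using scalar_prod_self_nonneg[of "A *\<^sub>v a x"] by (simp add: sq_def)
  qed
  \<comment> \<open>Summed over the \<open>q\<close> blocks, the inequality \<open>block\<close>
    produces exactly the determinant term that \<open>\<Phi>\<close> subtracts. What remains depends
    on the given vectors only.\<close>
  have bdd: "bdd_below (\<Phi> ` GL)"
  proof (rule bdd_belowI2)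
    fix A assume A: "A \<in> GL"
    have "(\<Sum>b<q. ln ((det A)\<^sup>2) + 2 * ln (\<bar>det (Xb b)\<bar> / fact d)) \<le> (\<Sum>b<q. \<Sum>j<d. ln (sq A (b, j)))"
    proof (rule sum_mono)
      fix b assume "b \<in> {..<q}"
      then have b: "b < q" by simp
      have nz: "det (Xb b) \<noteq> 0" "det A \<noteq> 0" using indep[OF b] A by (auto simp: Xb_def GL_def)
      have p: "\<And>j. j < d \<Longrightarrow> sq A (b, j) > 0" using pos[OF A] b by (auto simp: X_def)
      have prodpos: "0 < (\<Prod>j<d. sqrt (sq A (b, j)))" by (intro prod_pos) (simp add: p)
      have "ln (\<bar>det A\<bar> * (\<bar>det (Xb b)\<bar> / fact d)) \<le> ln (\<Prod>j<d. sqrt (sq A (b, j)))"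
        using block[OF A b] nz prodpos by (subst ln_le_cancel_iff) (simp_all add: field_simps)
      also have "\<dots> = (\<Sum>j<d. ln (sqrt (sq A (b, j))))"
        using p by (intro ln_prod) (force dest: p)+
      also have "\<dots> = (\<Sum>j<d. ln (sq A (b, j)) / 2)"
        using p by (intro sum.cong refl ln_sqrt) (auto simp: less_imp_le)
      finally have "ln \<bar>det A\<bar> + ln (\<bar>det (Xb b)\<bar> / fact d) \<le> (\<Sum>j<d. ln (sq A (b, j))) / 2"
        using nz by (subst (asm) ln_mult) (auto simp: sum_divide_distrib)
      moreover have "ln ((det A)\<^sup>2) = 2 * ln \<bar>det A\<bar>"
        using nz ln_realpow[of "\<bar>det A\<bar>" 2] by simp
      ultimately show "ln ((det A)\<^sup>2) + 2 * ln (\<bar>det (Xb b)\<bar> / fact d) \<le> (\<Sum>j<d. ln (sq A (b, j)))"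
        by simp
    qed
    then show "(\<Sum>b<q. 2 * ln (\<bar>det (Xb b)\<bar> / fact d)) \<le> \<Phi> A"
      by (simp add: \<Phi>_def X_def sum.cartesian_product sum.distrib)
  qed
  have "1\<^sub>m d \<in> GL" by (simp add: GL_def)
  then have "\<Phi> ` GL \<noteq> {}" by auto
  \<comment> \<open>The slack 1/10 is affordable because q ln 2 - q/2 is at least 1/6 for q \<ge>
    1.\<close>
  then obtain A where A: "A \<in> GL" and near: "\<Phi> A < Inf (\<Phi> ` GL) + 1 / 10"
    using cInf_lessD[of "\<Phi> ` GL" "Inf (\<Phi> ` GL) + 1 / 10"] by auto
  have Ac: "A \<in> carrier_mat d d" and Adet: "det A \<noteq> 0" using A by (auto simp: GL_def)
  have "real q / 2 \<le> (\<Sum>x\<in>X. ((A *\<^sub>v a x) \<bullet> v)\<^sup>2 / sq A x)"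
    if v: "v \<in> carrier_vec d" "v \<bullet> v = 1" for v
  proof -
    define t where "t = sqrt 2 - 1"
    have t: "2 * t + t\<^sup>2 = 1" by (simp add: t_def power2_eq_square algebra_simps)
    define B where "B = mat d d (\<lambda>(i, j). of_bool (i = j) + (t \<cdot>\<^sub>v v) $ i * v $ j)"
    have Bc: "B \<in> carrier_mat d d" by (simp add: B_def)
    have "det B = 1 + v \<bullet> (t \<cdot>\<^sub>v v)"
      unfolding B_def by (rule det_one_plus_rank_one) (use v in auto)
    then have "det B = sqrt 2" using v by (simp add: t_def)
    then have detBA: "det (B * A) = sqrt 2 * det A" using det_mult[OF Bc Ac] by simp
    have BA: "B * A \<in> GL" using Bc Ac Adet detBA by (simp add: GL_def)
    have sqBA: "sq (B * A) x = sq A x + ((A *\<^sub>v a x) \<bullet> v)\<^sup>2" if "x \<in> X" for x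
    proof -
      have "A *\<^sub>v a x \<in> carrier_vec d" using a'[OF that] Ac by simp
      then have "(B *\<^sub>v (A *\<^sub>v a x)) \<bullet> (B *\<^sub>v (A *\<^sub>v a x)) = sq A x + ((A *\<^sub>v a x) \<bullet> v)\<^sup>2"
        unfolding B_def sq_def using scalar_prod_self_stretch v t by blast
      then show ?thesis
        using Ac Bc a'[OF that] by (simp add: sq_def assoc_mult_mat_vec[of _ d d _ d])
    qed
    \<comment> \<open>The stretching doubles the squared determinant, which lowers
      \<open>\<Phi>\<close> by q ln 2. Near-minimality forces the lengths of the images to make up
      for this.\<close>
    have "\<Phi> A - 1 / 10 \<le> \<Phi> (B * A)"
      using near cInf_lower[OF imageI[OF BA, of \<Phi>] bdd] by simp
    then have "q * ln 2 - 1 / 10 \<le> (\<Sum>x\<in>X. ln (sq (B * A) x)) - (\<Sum>x\<in>X. ln (sq A x))"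
      using Adet by (simp add: \<Phi>_def detBA power_mult_distrib ln_mult algebra_simps)
    also have "\<dots> = (\<Sum>x\<in>X. ln (sq (B * A) x / sq A x))"
      unfolding sum_subtractf[symmetric]
      using pos[OF A] pos[OF BA] by (intro sum.cong refl) (metis less_irrefl ln_divide_pos)
    also have "\<dots> \<le> (\<Sum>x\<in>X. ((A *\<^sub>v a x) \<bullet> v)\<^sup>2 / sq A x)"
    proof (rule sum_mono)
      fix x assume x: "x \<in> X"
      have "ln (1 + ((A *\<^sub>v a x) \<bullet> v)\<^sup>2 / sq A x) \<le> ((A *\<^sub>v a x) \<bullet> v)\<^sup>2 / sq A x"
        using pos[OF A x] by (intro ln_add_one_self_le_self) auto
      then show "ln (sq (B * A) x / sq A x) \<le> ((A *\<^sub>v a x) \<bullet> v)\<^sup>2 / sq A x"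
        using pos[OF A x] by (simp add: sqBA[OF x] add_divide_distrib)
    qed
    finally have "q * ln 2 - 1 / 10 \<le> (\<Sum>x\<in>X. ((A *\<^sub>v a x) \<bullet> v)\<^sup>2 / sq A x)" .
    moreover have "real q * (2 / 3) \<le> q * ln 2"
      using ln2_ge_two_thirds by (intro mult_left_mono) auto
    moreover have "real q \<ge> 1" using q by simp
    ultimately show ?thesis by linarith
  qed
  with that[OF Ac Adet] pos[OF A] show thesis unfolding sq_def X_def by blast
qed

subsection \<open>Sign rank and operator norm\<close>

lemma scalar_prod_Cauchy_Schwarz:
  fixes u v :: "real vec"
  assumes "u \<in> carrier_vec d" "v \<in> carrier_vec d"
  shows "(u \<bullet> v)\<^sup>2 \<le> (u \<bullet> u) * (v \<bullet> v)"
  using Cauchy_Schwarz_ineq_sum[of "\<lambda>i. u $ i" "\<lambda>i. v $ i" "{0..<d}"] assms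
  by (simp add: scalar_prod_def power2_eq_square)

lemma normalize_vec:
  fixes v :: "real vec"
  assumes "v \<bullet> v > 0"
  shows "((1 / sqrt (v \<bullet> v)) \<cdot>\<^sub>v v) \<bullet> ((1 / sqrt (v \<bullet> v)) \<cdot>\<^sub>v v) = 1"
  using assms by (simp add: scalar_prod_def flip: sum_distrib_left sum_divide_distrib)

lemma scalar_prod_pos:
  fixes v w :: "real vec"
  assumes "v \<in> carrier_vec d" "w \<in> carrier_vec d" "v \<bullet> w \<noteq> 0"
  shows "w \<bullet> w > 0"
  using scalar_prod_Cauchy_Schwarz[OF assms(1,2)] assms(3) scalar_prod_self_nonneg[of w]
  by (cases "w \<bullet> w = 0") auto

lemma det_nonzero_left_inverse:
  fixes A :: "real mat"
  assumes "A \<in> carrier_mat d d" "det A \<noteq> 0"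
  obtains C where "C \<in> carrier_mat d d" "C * A = 1\<^sub>m d"
  using det_non_zero_imp_unit[OF assms, of "()"] by (auto simp: Units_def ring_mat_def)

text \<open>Forster's double estimate of the sum of \<open>M x y\<close> times the inner products of
  the normalised vectors. Near isotropy gives at least \<gamma> q / 2 for each \<open>y\<close>. The
  hypothesis \<open>opnorm\<close>, an operator norm bound in AM-GM form, gives at most L per
  \<open>y\<close> on average.\<close>

lemma sign_rank_bound_indep:
  fixes M :: "nat \<times> nat \<Rightarrow> 'y \<Rightarrow> real" and a :: "nat \<times> nat \<Rightarrow> real vec" and b :: "'y \<Rightarrow> real vec"
    and q d :: nat
  defines "X \<equiv> {..<q} \<times> {..<d}"
  assumes q: "q > 0" and d: "d > 0" and Y: "finite Y" "card Y = q * d" and \<gamma>: "\<gamma> \<ge> 0"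
    and a: "\<And>x. x \<in> X \<Longrightarrow> a x \<in> carrier_vec d" and b: "\<And>y. y \<in> Y \<Longrightarrow> b y \<in> carrier_vec d"
    and indep: "\<And>r. r < q \<Longrightarrow> det (mat d d (\<lambda>(i, j). a (r, j) $ i)) \<noteq> 0"
    and sign: "\<And>x y. x \<in> X \<Longrightarrow> y \<in> Y \<Longrightarrow> M x y * (a x \<bullet> b y) > 0"
    and large: "\<And>x y. x \<in> X \<Longrightarrow> y \<in> Y \<Longrightarrow> \<bar>M x y\<bar> \<ge> \<gamma>"
    and opnorm: "\<And>u v. (\<Sum>x\<in>X. \<Sum>y\<in>Y. M x y * u x * v y) \<le> L * ((\<Sum>x\<in>X. (u x)\<^sup>2) + (\<Sum>y\<in>Y. (v y)\<^sup>2)) / 2"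
  shows "\<gamma> * q \<le> 2 * L"
proof -
  have ac: "\<And>r j. r < q \<Longrightarrow> j < d \<Longrightarrow> a (r, j) \<in> carrier_vec d" using a by (simp add: X_def)
  obtain A where A: "A \<in> carrier_mat d d" "det A \<noteq> 0"
    and Apos: "\<And>x. x \<in> X \<Longrightarrow> (A *\<^sub>v a x) \<bullet> (A *\<^sub>v a x) > 0"
    and iso: "\<And>v. v \<in> carrier_vec d \<Longrightarrow> v \<bullet> v = 1 \<Longrightarrow>
       real q / 2 \<le> (\<Sum>x\<in>X. ((A *\<^sub>v a x) \<bullet> v)\<^sup>2 / ((A *\<^sub>v a x) \<bullet> (A *\<^sub>v a x)))"
    by (rule ex_near_isotropic_position[OF q ac indep, folded X_def]) (assumption+, rule that, blast+)
  obtain C where C: "C \<in> carrier_mat d d" "C * A = 1\<^sub>m d" using det_nonzero_left_inverse A by blast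
  \<comment> \<open>The vectors of the other side move by the inverse transpose of \<open>A\<close>,
    so that all inner products are kept.\<close>
  define B where "B y = C\<^sup>T *\<^sub>v b y" for y
  have Aa: "A *\<^sub>v a x \<in> carrier_vec d" if "x \<in> X" for x using A a[OF that] by simp
  have B: "B y \<in> carrier_vec d" if "y \<in> Y" for y using C b[OF that] by (simp add: B_def)
  have AB: "(A *\<^sub>v a x) \<bullet> B y = a x \<bullet> b y" if "x \<in> X" "y \<in> Y" for x y
  proof -
    have "(A *\<^sub>v a x) \<bullet> B y = B y \<bullet> (A *\<^sub>v a x)"
      using comm_scalar_prod Aa B that by blast
    also have "\<dots> = b y \<bullet> (C *\<^sub>v (A *\<^sub>v a x))"
      unfolding B_def using transpose_vec_mult_scalar[OF C(1) Aa[OF that(1)] b[OF that(2)]] by simp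
    also have "C *\<^sub>v (A *\<^sub>v a x) = a x"
      using assoc_mult_mat_vec[OF C(1) A(1) a[OF that(1)]] C(2) a[OF that(1)] by simp
    finally show ?thesis using comm_scalar_prod[OF a b] that by simp
  qed
  have X0: "(0, 0) \<in> X" using q d by (simp add: X_def)
  have Bpos: "B y \<bullet> B y > 0" if "y \<in> Y" for y
  proof -
    have "a (0, 0) \<bullet> b y \<noteq> 0" using sign[OF X0 that] by (metis less_irrefl mult_zero_right)
    then show ?thesis using scalar_prod_pos[OF Aa[OF X0] B[OF that]] AB[OF X0 that] by simp
  qed
  define u where "u x = (1 / sqrt ((A *\<^sub>v a x) \<bullet> (A *\<^sub>v a x))) \<cdot>\<^sub>v (A *\<^sub>v a x)" for x
  define w where "w y = (1 / sqrt (B y \<bullet> B y)) \<cdot>\<^sub>v B y" for y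
  have u: "u x \<in> carrier_vec d" "u x \<bullet> u x = 1" if "x \<in> X" for x
    unfolding u_def using normalize_vec[OF Apos[OF that]] Aa[OF that] by auto
  have w: "w y \<in> carrier_vec d" "w y \<bullet> w y = 1" if "y \<in> Y" for y
    unfolding w_def using normalize_vec[OF Bpos[OF that]] B[OF that] by auto
  have uw: "u x \<bullet> w y = (a x \<bullet> b y) * (1 / sqrt ((A *\<^sub>v a x) \<bullet> (A *\<^sub>v a x)) / sqrt (B y \<bullet> B y))"
    if "x \<in> X" "y \<in> Y" for x y
    unfolding u_def w_def using AB[OF that] Aa[OF that(1)] B[OF that(2)] by simp
  have iso_u: "real q / 2 \<le> (\<Sum>x\<in>X. (u x \<bullet> w y)\<^sup>2)" if y: "y \<in> Y" for y
  proof -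
    have "(u x \<bullet> w y)\<^sup>2 = ((A *\<^sub>v a x) \<bullet> w y)\<^sup>2 / ((A *\<^sub>v a x) \<bullet> (A *\<^sub>v a x))" if x: "x \<in> X" for x
    proof -
      have "u x \<bullet> w y = ((A *\<^sub>v a x) \<bullet> w y) / sqrt ((A *\<^sub>v a x) \<bullet> (A *\<^sub>v a x))"
        unfolding u_def using Aa[OF x] w[OF y] by simp
      then show ?thesis using Apos[OF x] by (simp add: power_divide)
    qed
    then show ?thesis using iso[OF w[OF y]] by simp
  qed
  \<comment> \<open>Inner products of unit vectors are at most 1 in modulus, so the modulus
    dominates the square, which is the quantity that isotropy controls.\<close>
  have term_ge: "\<gamma> * (u x \<bullet> w y)\<^sup>2 \<le> M x y * (u x \<bullet> w y)" if x: "x \<in> X" and y: "y \<in> Y" for x y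
  proof -
    have "M x y * (u x \<bullet> w y) > 0"
      unfolding uw[OF x y] using sign[OF x y] Apos[OF x] Bpos[OF y]
      by (subst mult.assoc[symmetric]) (rule mult_pos_pos; simp)
    then have eq: "M x y * (u x \<bullet> w y) = \<bar>M x y\<bar> * \<bar>u x \<bullet> w y\<bar>" by (simp flip: abs_mult)
    have "\<bar>u x \<bullet> w y\<bar> \<le> 1"
      using scalar_prod_Cauchy_Schwarz[OF u(1)[OF x] w(1)[OF y]] u(2)[OF x] w(2)[OF y] by (simp add: abs_square_le_1)
    then have "\<bar>u x \<bullet> w y\<bar> * \<bar>u x \<bullet> w y\<bar> \<le> 1 * \<bar>u x \<bullet> w y\<bar>"
      by (intro mult_right_mono) auto
    then have "(u x \<bullet> w y)\<^sup>2 \<le> \<bar>u x \<bullet> w y\<bar>" by (simp add: power2_eq_square)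
    then show ?thesis unfolding eq using large[OF x y] \<gamma> by (intro mult_mono) auto
  qed
  have "\<gamma> * (card Y * (real q / 2)) = \<gamma> * (\<Sum>y\<in>Y. real q / 2)" by simp
  also have "\<dots> \<le> \<gamma> * (\<Sum>y\<in>Y. \<Sum>x\<in>X. (u x \<bullet> w y)\<^sup>2)"
    using iso_u \<gamma> by (intro mult_left_mono sum_mono) auto
  also have "\<dots> \<le> (\<Sum>y\<in>Y. \<Sum>x\<in>X. M x y * (u x \<bullet> w y))"
    using term_ge by (auto simp: sum_distrib_left intro!: sum_mono)
  also have "\<dots> = (\<Sum>y\<in>Y. \<Sum>x\<in>X. \<Sum>k = 0..<d. M x y * u x $ k * w y $ k)"
  proof (intro sum.cong refl)
    fix x y assume "x \<in> X" "y \<in> Y"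
    then have "dim_vec (w y) = d" using w by auto
    then show "M x y * (u x \<bullet> w y) = (\<Sum>k = 0..<d. M x y * u x $ k * w y $ k)"
      by (simp add: scalar_prod_def sum_distrib_left mult.assoc)
  qed
  also have "\<dots> = (\<Sum>y\<in>Y. \<Sum>k = 0..<d. \<Sum>x\<in>X. M x y * u x $ k * w y $ k)"
    by (intro sum.cong refl sum.swap)
  also have "\<dots> = (\<Sum>k = 0..<d. \<Sum>y\<in>Y. \<Sum>x\<in>X. M x y * u x $ k * w y $ k)"
    by (rule sum.swap)
  also have "\<dots> = (\<Sum>k = 0..<d. \<Sum>x\<in>X. \<Sum>y\<in>Y. M x y * u x $ k * w y $ k)"
    by (intro sum.cong refl sum.swap)
  \<comment> \<open>The bilinear bound is applied once for each coordinate \<open>k\<close>; the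
    squared coordinates then add up to squared lengths, all equal to 1.\<close>
  also have "\<dots> \<le> (\<Sum>k = 0..<d. L * ((\<Sum>x\<in>X. (u x $ k)\<^sup>2) + (\<Sum>y\<in>Y. (w y $ k)\<^sup>2)) / 2)"
    by (intro sum_mono opnorm)
  also have "\<dots> = L * ((\<Sum>k = 0..<d. \<Sum>x\<in>X. (u x $ k)\<^sup>2) + (\<Sum>k = 0..<d. \<Sum>y\<in>Y. (w y $ k)\<^sup>2)) / 2"
    by (simp add: sum.distrib flip: sum_distrib_left sum_divide_distrib)
  also have "(\<Sum>k = 0..<d. \<Sum>x\<in>X. (u x $ k)\<^sup>2) = (\<Sum>x\<in>X. \<Sum>k = 0..<d. (u x $ k)\<^sup>2)"
    by (rule sum.swap)
  also have "\<dots> = (\<Sum>x\<in>X. u x \<bullet> u x)"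
    by (intro sum.cong refl) (simp add: scalar_prod_def power2_eq_square carrier_vecD[OF u(1)])
  also have "\<dots> = card Y" using u(2) Y by (simp add: X_def)
  also have "(\<Sum>k = 0..<d. \<Sum>y\<in>Y. (w y $ k)\<^sup>2) = (\<Sum>y\<in>Y. \<Sum>k = 0..<d. (w y $ k)\<^sup>2)"
    by (rule sum.swap)
  also have "\<dots> = (\<Sum>y\<in>Y. w y \<bullet> w y)"
    by (intro sum.cong refl) (simp add: scalar_prod_def power2_eq_square carrier_vecD[OF w(1)])
  also have "\<dots> = card Y" using w(2) by simp
  finally have "real (card Y) * (\<gamma> * q) \<le> real (card Y) * (2 * L)" by (simp add: algebra_simps)
  moreover have "real (card Y) > 0" using Y q d by simp
  ultimately show ?thesis by (simp only: mult_le_cancel_left_pos)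
qed

text \<open>Finitely many strict sign conditions survive a small change of the vectors
  \<open>a x\<close>. So \<open>X\<close> is cut into \<open>q\<close> blocks of size
  \<open>d\<close>, and each block is perturbed into a basis.\<close>

lemma sign_rank_bound:
  fixes M :: "'x \<Rightarrow> 'y \<Rightarrow> real" and a :: "'x \<Rightarrow> real vec" and b :: "'y \<Rightarrow> real vec"
  assumes q: "q > 0" and d: "d > 0" and X: "finite X" "card X = q * d" and Y: "finite Y" "card Y = q * d"
    and \<gamma>: "\<gamma> \<ge> 0"
    and a: "\<And>x. x \<in> X \<Longrightarrow> a x \<in> carrier_vec d" and b: "\<And>y. y \<in> Y \<Longrightarrow> b y \<in> carrier_vec d"
    and sign: "\<And>x y. x \<in> X \<Longrightarrow> y \<in> Y \<Longrightarrow> M x y * (a x \<bullet> b y) > 0"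
    and large: "\<And>x y. x \<in> X \<Longrightarrow> y \<in> Y \<Longrightarrow> \<bar>M x y\<bar> \<ge> \<gamma>"
    and opnorm: "\<And>u v. (\<Sum>x\<in>X. \<Sum>y\<in>Y. M x y * u x * v y) \<le> L * ((\<Sum>x\<in>X. (u x)\<^sup>2) + (\<Sum>y\<in>Y. (v y)\<^sup>2)) / 2"
  shows "\<gamma> * q \<le> 2 * L"
proof -
  define I where "I = {..<q} \<times> {..<d}"
  have "finite I" "card I = card X" by (auto simp: I_def X)
  then obtain e where e: "bij_betw e I X" using finite_same_card_bij X by metis
  have eX: "e i \<in> X" if "i \<in> I" for i using e that by (auto simp: bij_betw_def)
  \<comment> \<open>This adds \<open>t\<close> times the identity to each block, which makes it regular for all but finitely many \<open>t\<close>.\<close>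
  define a' where "a' t i = a (e i) + t \<cdot>\<^sub>v unit_vec d (snd i)" for t i
  have "\<forall>\<^sub>F t in at_right (0::real). \<forall>r\<in>{..<q}. det (mat d d (\<lambda>(i, j). a' t (r, j) $ i)) \<noteq> 0"
  proof (rule eventually_ball_finite, simp, intro ballI)
    fix r assume r: "r \<in> {..<q}"
    define P where "P = mat d d (\<lambda>(i, j). a (e (r, j)) $ i)"
    have P: "P \<in> carrier_mat d d" by (simp add: P_def)
    have "\<forall>\<^sub>F t in at_right 0. \<forall>s\<in>uminus ` spectrum P. t \<noteq> s"
      using card_finite_spectrum(1)[OF P]
      by (intro eventually_ball_finite) (auto intro: eventually_neq_at_within)
    then show "\<forall>\<^sub>F t in at_right 0. det (mat d d (\<lambda>(i, j). a' t (r, j) $ i)) \<noteq> 0"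
    proof eventually_elim
      case (elim t)
      have ac: "a (e (r, j)) \<in> carrier_vec d" if "j < d" for j
        using a eX that r by (auto simp: I_def)
      \<comment> \<open>The perturbed block is P + t I, which is singular exactly when -t is an
        eigenvalue of \<open>P\<close>.\<close>
      have "mat d d (\<lambda>(i, j). a' t (r, j) $ i) = char_matrix P (- t)"
        by (rule eq_matI) (auto simp: a'_def char_matrix_def P_def dest: ac)
      moreover have "\<not> eigenvalue P (- t)" using elim by (force simp: spectrum_def)
      ultimately show ?case using eigenvalue_det[OF P] by simp
    qed
  qed
  moreover have "\<forall>\<^sub>F t in at_right (0::real). \<forall>i\<in>I. \<forall>y\<in>Y. M (e i) y * (a' t i \<bullet> b y) > 0"
  proof (intro eventually_ball_finite ballI)
    fix i y assume i: "i \<in> I" and y: "y \<in> Y"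
    obtain r j where ij: "i = (r, j)" by force
    have eq: "a' t i \<bullet> b y = a (e i) \<bullet> b y + t * (b y $ j)" for t
    proof -
      have "a' t i \<bullet> b y = a (e i) \<bullet> b y + (t \<cdot>\<^sub>v unit_vec d j) \<bullet> b y"
        unfolding a'_def ij snd_conv using a[OF eX[OF i]] b[OF y] ij
        by (intro add_scalar_prod_distrib) auto
      then show ?thesis using b[OF y] i ij by (simp add: I_def scalar_prod_left_unit)
    qed
    have "((\<lambda>t. M (e i) y * (a' t i \<bullet> b y)) \<longlongrightarrow> M (e i) y * (a (e i) \<bullet> b y + 0 * (b y $ j))) (at_right 0)"
      unfolding eq by (intro tendsto_intros)
    then show "\<forall>\<^sub>F t in at_right 0. M (e i) y * (a' t i \<bullet> b y) > 0"
      using sign[OF eX[OF i] y] by (intro order_tendstoD(1)) simp_all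
  qed (simp_all add: I_def Y)
  ultimately have "\<forall>\<^sub>F t in at_right (0::real).
      (\<forall>r\<in>{..<q}. det (mat d d (\<lambda>(i, j). a' t (r, j) $ i)) \<noteq> 0) \<and>
      (\<forall>i\<in>I. \<forall>y\<in>Y. M (e i) y * (a' t i \<bullet> b y) > 0)"
    by (rule eventually_conj)
  then obtain t where t: "\<forall>r\<in>{..<q}. det (mat d d (\<lambda>(i, j). a' t (r, j) $ i)) \<noteq> 0"
      "\<forall>i\<in>I. \<forall>y\<in>Y. M (e i) y * (a' t i \<bullet> b y) > 0"
    using eventually_happens'[OF trivial_limit_at_right_real] by blast
  show ?thesis
  proof (rule sign_rank_bound_indep[OF q d Y \<gamma>, of "a' t" b "\<lambda>i. M (e i)"], fold I_def)
    fix u :: "nat \<times> nat \<Rightarrow> real" and v :: "'y \<Rightarrow> real"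
    define u' where "u' = u \<circ> inv_into I e"
    have u': "u' (e i) = u i" if "i \<in> I" for i
      using e that by (simp add: u'_def bij_betw_def)
    have 1: "(\<Sum>i\<in>I. \<Sum>y\<in>Y. M (e i) y * u i * v y) = (\<Sum>x\<in>X. \<Sum>y\<in>Y. M x y * u' x * v y)"
      by (subst sum.reindex_bij_betw[OF e, symmetric]) (simp add: u')
    have 2: "(\<Sum>i\<in>I. (u i)\<^sup>2) = (\<Sum>x\<in>X. (u' x)\<^sup>2)"
      by (subst sum.reindex_bij_betw[OF e, symmetric]) (simp add: u')
    show "(\<Sum>i\<in>I. \<Sum>y\<in>Y. M (e i) y * u i * v y) \<le> L * ((\<Sum>i\<in>I. (u i)\<^sup>2) + (\<Sum>y\<in>Y. (v y)\<^sup>2)) / 2"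
      unfolding 1 2 by (rule opnorm)
  next
    show "a' t i \<in> carrier_vec d" if "i \<in> I" for i
      using a[OF eX[OF that]] by (simp add: a'_def)
    show "det (mat d d (\<lambda>(i, j). a' t (r, j) $ i)) \<noteq> 0" if "r < q" for r
      using t(1) that by simp
    show "M (e i) y * (a' t i \<bullet> b y) > 0" if "i \<in> I" "y \<in> Y" for i y
      using t(2) that by simp
    show "\<bar>M (e i) y\<bar> \<ge> \<gamma>" if "i \<in> I" "y \<in> Y" for i y
      using large[OF eX] that by simp
    show "b y \<in> carrier_vec d" if "y \<in> Y" for y using b that .
  qed
qed

subsection \<open>Spectral norms of XOR matrices\<close>

definition hamming :: "bool list \<Rightarrow> nat" where
  "hamming x = (\<Sum>i<length x. of_bool (x ! i))"

lemma hamming_Nil [simp]: "hamming [] = 0"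
  by (simp add: hamming_def)

lemma hamming_Cons [simp]: "hamming (c # x) = of_bool c + hamming x"
  unfolding hamming_def by (simp add: sum.lessThan_Suc_shift del: sum.lessThan_Suc)

lemma xor_bits_Nil [simp]: "xor_bits [] [] = []"
  by (simp add: xor_bits_def)

lemma xor_bits_Cons [simp]: "xor_bits (c # x) (d # y) = (c \<noteq> d) # xor_bits x y"
  by (simp add: xor_bits_def)

lemma cube_0 [simp]: "cube 0 = {[]}"
  by (auto simp: cube_def)

lemma cube_Suc: "cube (Suc n) = Cons True ` cube n \<union> Cons False ` cube n"
  by (auto simp: cube_def length_Suc_conv image_iff)

lemma finite_cube [simp]: "finite (cube n)"
  by (induction n) (auto simp: cube_Suc)

lemma sum_cube_Suc:
  fixes f :: "bool list \<Rightarrow> 'a::comm_monoid_add"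
  shows "(\<Sum>x\<in>cube (Suc n). f x) = (\<Sum>x\<in>cube n. f (True # x) + f (False # x))"
  unfolding cube_Suc
  by (subst sum.union_disjoint) (auto simp: sum.reindex sum.distrib inj_on_def)

lemma card_cube: "card (cube n) = 2 ^ n"
proof (induction n)
  case (Suc n)
  then show ?case using sum_cube_Suc[of "\<lambda>_. 1::nat" n] by simp
qed simp

text \<open>The matrix \<open>z\<^bsup>hamming (x \<oplus> y)\<^esup>\<close> is the \<open>n\<close>-th tensor power of the symmetric matrix
  with entries \<open>1, z\<close>, whose eigenvalues are \<open>1 + z\<close> and \<open>1 - z\<close>. The operator norm is expressed
  by an AM-GM bound on the bilinear form.\<close>

lemma norm_xor_power_form_le:
  fixes z :: complex and u v :: "bool list \<Rightarrow> real"
  assumes plus: "norm (1 + z) \<le> \<rho>" and minus: "norm (1 - z) \<le> \<rho>"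
  shows "norm (\<Sum>x\<in>cube n. \<Sum>y\<in>cube n. z ^ hamming (xor_bits x y) * of_real (u x * v y))
    \<le> \<rho> ^ n * ((\<Sum>x\<in>cube n. (u x)\<^sup>2) + (\<Sum>y\<in>cube n. (v y)\<^sup>2)) / 2"
proof (induction n arbitrary: u v)
  case 0
  have "2 * (\<bar>u []\<bar> * \<bar>v []\<bar>) \<le> \<bar>u []\<bar>\<^sup>2 + \<bar>v []\<bar>\<^sup>2"
    using sum_squares_bound[of "\<bar>u []\<bar>" "\<bar>v []\<bar>"] by (simp only: mult.assoc)
  then show ?case by (simp add: norm_mult)
next
  case (Suc n)
  define T where "T u v = (\<Sum>x\<in>cube n. \<Sum>y\<in>cube n. z ^ hamming (xor_bits x y) * of_real (u x * v y))"
    for u v :: "bool list \<Rightarrow> real"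
  define E where "E u v = (\<Sum>x\<in>cube n. (u x)\<^sup>2) + (\<Sum>y\<in>cube n. (v y)\<^sup>2)"
    for u v :: "bool list \<Rightarrow> real"
  have \<rho>: "\<rho> \<ge> 0" using plus norm_ge_zero order_trans by blast
  have IH: "norm (T u v) \<le> \<rho> ^ n * E u v / 2" for u v
    using Suc.IH unfolding T_def E_def .
  \<comment> \<open>Sums and differences over the first bit are coordinates in the eigenbasis of the
    first tensor factor, up to scaling; they split the form according to the eigenvalues 1 + z and 1
    - z.\<close>
  define up um vp vm where "up = (\<lambda>x. u (True # x) + u (False # x))"
    and "um = (\<lambda>x. u (True # x) - u (False # x))"
    and "vp = (\<lambda>y. v (True # y) + v (False # y))"
    and "vm = (\<lambda>y. v (True # y) - v (False # y))"
  have "(\<Sum>x\<in>cube (Suc n). \<Sum>y\<in>cube (Suc n). z ^ hamming (xor_bits x y) * of_real (u x * v y))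
      = (1 + z) / 2 * T up vp + (1 - z) / 2 * T um vm"
    unfolding T_def sum_distrib_left sum.distrib[symmetric] sum_cube_Suc
    by (intro sum.cong refl) (simp add: up_def um_def vp_def vm_def field_simps)
  also have "norm \<dots> \<le> norm ((1 + z) / 2) * norm (T up vp) + norm ((1 - z) / 2) * norm (T um vm)"
    by (intro norm_triangle_le add_mono) (simp_all add: norm_mult)
  also have "\<dots> \<le> \<rho> / 2 * (\<rho> ^ n * E up vp / 2) + \<rho> / 2 * (\<rho> ^ n * E um vm / 2)"
    using plus minus \<rho> by (intro add_mono mult_mono IH) (auto simp: norm_divide)
  also have "\<dots> = \<rho> ^ Suc n * ((E up vp + E um vm) / 2) / 2"
    by (simp add: algebra_simps)
  \<comment> \<open>The parallelogram law.\<close>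
  also have "(E up vp + E um vm) / 2 = (\<Sum>x\<in>cube (Suc n). (u x)\<^sup>2) + (\<Sum>y\<in>cube (Suc n). (v y)\<^sup>2)"
    unfolding E_def sum_cube_Suc up_def um_def vp_def vm_def
    by (simp add: power2_eq_square algebra_simps sum.distrib sum_subtractf)
  finally show ?case .
qed

section \<open>Distances of roots of unity from 1 and -1\<close>

text \<open>The powers of \<open>\<eta>\<close> sum to 0, so m is the sum of the differences 1 -
  \<eta>^k over k < m. Each is at most k times the modulus of 1 - \<eta>, and the k sum to at most
  m^2 / 2.\<close>

lemma root_of_unity_dist_1:
  fixes \<eta> :: complex
  assumes m: "m > 0" and root: "\<eta> ^ m = 1" and ne: "\<eta> \<noteq> 1"
  shows "2 / m \<le> norm (1 - \<eta>)"
proof -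
  have "norm \<eta> ^ m = 1" using root by (metis norm_one norm_power)
  then have n1: "norm \<eta> = 1" using m power_eq_imp_eq_base[of "norm \<eta>" m 1] by simp
  have id_sum: "(\<Sum>k<m. real k) \<le> (real m)\<^sup>2 / 2" for m :: nat
    by (induction m) (auto simp: power2_eq_square field_simps)
  have "(\<Sum>k<m. \<eta> ^ k) = 0" using ne root by (simp add: sum_gp_strict)
  then have "of_nat m = (\<Sum>k<m. 1 ^ k - \<eta> ^ k)" by (simp add: sum_subtractf)
  then have "real m = norm (\<Sum>k<m. 1 ^ k - \<eta> ^ k)" by (metis norm_of_nat)
  also have "\<dots> \<le> (\<Sum>k<m. norm (1 ^ k - \<eta> ^ k))" by (rule norm_sum)
  also have "\<dots> \<le> (\<Sum>k<m. real k * norm (1 - \<eta>))"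
    using n1 by (intro sum_mono norm_power_diff) auto
  also have "\<dots> = (\<Sum>k<m. real k) * norm (1 - \<eta>)" by (simp add: sum_distrib_right)
  also have "\<dots> \<le> (real m)\<^sup>2 / 2 * norm (1 - \<eta>)" by (intro mult_right_mono id_sum) auto
  finally show ?thesis using m by (simp add: field_simps power2_eq_square)
qed

text \<open>Both factors of \<open>1 - z\<^sup>2 = (1 - z) (1 + z)\<close> have modulus at most 2, so each one
  is bounded away from 0; as the squares of their moduli sum to 4, each one is bounded away from 2.\<close>

lemma norm_one_pm_root_le:
  fixes z :: complex
  assumes m: "m > 0" and root: "z ^ m = 1" and ne: "z\<^sup>2 \<noteq> 1"
  shows "norm (1 + z) \<le> 2 * exp (- 1 / (8 * (real m)\<^sup>2))"
    and "norm (1 - z) \<le> 2 * exp (- 1 / (8 * (real m)\<^sup>2))"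
proof -
  have "norm z ^ m = 1" using root by (metis norm_one norm_power)
  then have n1: "norm z = 1" using m power_eq_imp_eq_base[of "norm z" m 1] by simp
  define P Q where "P = (norm (1 + z))\<^sup>2" and "Q = (norm (1 - z))\<^sup>2"
  have PQ: "P + Q = 4"
    using n1 unfolding P_def Q_def cmod_power2 
    by (simp add: cmod_def power2_eq_square algebra_simps)
  have nonneg: "P \<ge> 0" "Q \<ge> 0" by (simp_all add: P_def Q_def)
  have "(z\<^sup>2) ^ m = 1" using root by (metis power_commutes power_mult power_one mult.commute)
  then have "2 / m \<le> norm (1 - z\<^sup>2)" by (intro root_of_unity_dist_1 m ne)
  also have "1 - z\<^sup>2 = (1 + z) * (1 - z)" by (simp add: algebra_simps power2_eq_square)
  finally have "(2 / m)\<^sup>2 \<le> (norm (1 + z) * norm (1 - z))\<^sup>2"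
    by (intro power_mono) (auto simp: norm_mult)
  then have prod: "4 / (real m)\<^sup>2 \<le> P * Q" by (simp add: P_def Q_def power_mult_distrib power_divide)
  \<comment> \<open>Here \<open>R\<close> will be the squared modulus of the other factor. Taking
    the square root turns 4 m^2 in the exponent into 8 m^2.\<close>
  have bound: "norm w \<le> 2 * exp (- 1 / (8 * (real m)\<^sup>2))"
    if w: "(norm w)\<^sup>2 = 4 - R" and R: "4 / (real m)\<^sup>2 \<le> 4 * R" for w :: complex and R
  proof (rule power2_le_imp_le)
    have "(norm w)\<^sup>2 \<le> 4 * (1 + - 1 / (4 * (real m)\<^sup>2))" using w R by simp
    also have "\<dots> \<le> 4 * exp (- 1 / (4 * (real m)\<^sup>2))"
      by (intro mult_left_mono exp_ge_add_one_self) auto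
    also have "\<dots> = (2 * exp (- 1 / (8 * (real m)\<^sup>2)))\<^sup>2"
      by (simp add: power2_eq_square mult_exp_exp)
    finally show "(norm w)\<^sup>2 \<le> (2 * exp (- 1 / (8 * (real m)\<^sup>2)))\<^sup>2" .
  qed simp
  have "P * Q \<le> 4 * Q" using PQ nonneg by (intro mult_right_mono) auto
  then show "norm (1 + z) \<le> 2 * exp (- 1 / (8 * (real m)\<^sup>2))"
    using PQ prod by (intro bound[of "1 + z" Q]) (auto simp: P_def)
  have "P * Q \<le> P * 4" using PQ nonneg by (intro mult_left_mono) auto
  then show "norm (1 - z) \<le> 2 * exp (- 1 / (8 * (real m)\<^sup>2))"
    using PQ prod by (intro bound[of "1 - z" P]) (auto simp: Q_def)
qed

text \<open>The Fourier coefficient at frequency 0 is the sum of \<open>h\<close> and vanishes. The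
  other m - 1 coefficients have modulus at most the sum of the moduli of \<open>h\<close>, and
  inversion divides by m.\<close>

lemma xor_mod_form_le:
  fixes h :: "nat \<Rightarrow> real" and u v :: "bool list \<Rightarrow> real"
  assumes m: "odd m" and balanced: "(\<Sum>r<m. h r) = 0"
  shows "\<bar>\<Sum>x\<in>cube n. \<Sum>y\<in>cube n. h (hamming (xor_bits x y) mod m) * u x * v y\<bar>
    \<le> (real m - 1) / m * (\<Sum>r<m. \<bar>h r\<bar>) * (2 * exp (- 1 / (8 * (real m)\<^sup>2))) ^ n
      * ((\<Sum>x\<in>cube n. (u x)\<^sup>2) + (\<Sum>y\<in>cube n. (v y)\<^sup>2)) / 2"
proof -
  have m0: "m > 0" using m by (cases m) auto
  define \<omega> where "\<omega> = exp (2 * of_real pi * \<i> * of_nat 1 / of_nat m)"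
  have \<omega>_pow: "\<omega> ^ k = exp (2 * of_real pi * \<i> * of_nat k / of_nat m)" for k
    unfolding \<omega>_def by (simp add: mult_ac flip: exp_of_nat_mult)
  have \<omega>_1: "\<omega> ^ k = 1 \<longleftrightarrow> m dvd k" for k
    unfolding \<omega>_pow using complex_root_unity_eq_1[of m k] m0 by simp
  have \<omega>_norm: "norm (\<omega> ^ k) = 1" for k
    unfolding \<omega>_pow by (simp add: norm_exp_eq_Re)
  have orth: "(\<Sum>j<m. (\<omega> ^ k) ^ j) = (if m dvd k then of_nat m else 0)" for k
  proof (cases "m dvd k")
    case False
    then have "\<omega> ^ k \<noteq> 1" "(\<omega> ^ k) ^ m = 1"
      using \<omega>_1[of "k * m"] by (simp_all add: \<omega>_1 power_mult)
    then show ?thesis using False by (simp add: sum_gp_strict)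
  qed (use \<omega>_1[of k] in simp)
  \<comment> \<open>The exponent \<open>m - r\<close> stands for -r and keeps all powers
    natural.\<close>
  have fourier: "of_nat m * of_real (h (s mod m)) =
      (\<Sum>j<m. (\<Sum>r<m. of_real (h r) * \<omega> ^ ((m - r) * j)) * (\<omega> ^ j) ^ s)" for s
  proof -
    have pow: "\<omega> ^ (k * j) * (\<omega> ^ j) ^ s = (\<omega> ^ (s + k)) ^ j" for j k
      by (simp add: algebra_simps flip: power_mult power_add)
    have "(\<Sum>j<m. (\<Sum>r<m. of_real (h r) * \<omega> ^ ((m - r) * j)) * (\<omega> ^ j) ^ s)
        = (\<Sum>j<m. \<Sum>r<m. of_real (h r) * (\<omega> ^ (s + (m - r))) ^ j)"
      by (simp only: sum_distrib_right mult.assoc pow)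
    also have "\<dots> = (\<Sum>r<m. of_real (h r) * (\<Sum>j<m. (\<omega> ^ (s + (m - r))) ^ j))"
      by (subst sum.swap) (simp add: sum_distrib_left)
    also have "\<dots> = (\<Sum>r<m. if r = s mod m then of_nat m * of_real (h r) else 0)"
    proof (intro sum.cong refl)
      fix r assume "r \<in> {..<m}"
      then have r: "r < m" by simp
      have "m dvd s + (m - r) \<longleftrightarrow> [s + (m - r) + r = r] (mod m)"
        using cong_add_rcancel_0_nat[of "s + (m - r)" r m] by (simp add: cong_0_iff)
      also have "s + (m - r) + r = s + m" using r by simp
      also have "[s + m = r] (mod m) \<longleftrightarrow> r = s mod m" using r by (auto simp: cong_def)
      finally show "of_real (h r) * (\<Sum>j<m. (\<omega> ^ (s + (m - r))) ^ j)
          = (if r = s mod m then of_nat m * of_real (h r) else 0 :: complex)"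
        by (simp add: orth)
    qed
    finally show ?thesis using m0 by simp
  qed
  define c where "c j = (\<Sum>r<m. of_real (h r) * \<omega> ^ ((m - r) * j))" for j
  define T where "T j = (\<Sum>x\<in>cube n. \<Sum>y\<in>cube n. (\<omega> ^ j) ^ hamming (xor_bits x y) * of_real (u x * v y))" for j
  define E where "E = (\<Sum>x\<in>cube n. (u x)\<^sup>2) + (\<Sum>y\<in>cube n. (v y)\<^sup>2)"
  define \<rho> where "\<rho> = 2 * exp (- 1 / (8 * (real m)\<^sup>2))"
  define S where "S = (\<Sum>r<m. \<bar>h r\<bar>)"
  have E0: "E \<ge> 0" by (auto simp: E_def intro!: add_nonneg_nonneg sum_nonneg)
  have c0: "c 0 = 0" using balanced by (simp add: c_def flip: of_real_sum)
  have c: "norm (c j) \<le> S" for j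
    unfolding c_def S_def
    by (rule order_trans[OF norm_sum]) (simp add: norm_mult \<omega>_norm)
  have T: "norm (T j) \<le> \<rho> ^ n * E / 2" if j: "j \<in> {0<..<m}" for j
  proof -
    have root: "(\<omega> ^ j) ^ m = 1" using \<omega>_1[of "j * m"] by (simp add: power_mult)
    \<comment> \<open>Oddness of \<open>m\<close> enters: a divisor of 2j would divide j, impossible
      for 0 < j < m. Hence \<open>\<omega> ^ j\<close> is neither 1 nor -1.\<close>
    have "\<not> m dvd j * 2"
      using j m nat_dvd_not_less[of j m] coprime_dvd_mult_left_iff[of m 2 j] by auto
    then have "(\<omega> ^ j)\<^sup>2 \<noteq> 1" using \<omega>_1[of "j * 2"] by (simp add: power_mult)
    from norm_one_pm_root_le[OF m0 root this] show ?thesis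
      unfolding T_def E_def \<rho>_def by (intro norm_xor_power_form_le)
  qed
  define W where "W = (\<Sum>x\<in>cube n. \<Sum>y\<in>cube n. h (hamming (xor_bits x y) mod m) * u x * v y)"
  have "of_nat m * of_real W
      = (\<Sum>x\<in>cube n. \<Sum>y\<in>cube n. (of_nat m * of_real (h (hamming (xor_bits x y) mod m))) * (of_real (u x * v y) :: complex))"
    by (simp add: W_def sum_distrib_left mult.assoc)
  also have "\<dots> = (\<Sum>x\<in>cube n. \<Sum>y\<in>cube n. \<Sum>j<m. c j * ((\<omega> ^ j) ^ hamming (xor_bits x y) * of_real (u x * v y)))"
    unfolding fourier c_def[symmetric] by (simp only: sum_distrib_right mult.assoc)
  also have "\<dots> = (\<Sum>x\<in>cube n. \<Sum>j<m. \<Sum>y\<in>cube n. c j * ((\<omega> ^ j) ^ hamming (xor_bits x y) * of_real (u x * v y)))"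
    by (intro sum.cong refl sum.swap)
  also have "\<dots> = (\<Sum>j<m. c j * T j)"
    unfolding T_def by (subst sum.swap) (simp only: sum_distrib_left)
  also have "\<dots> = (\<Sum>j\<in>{0<..<m}. c j * T j)"
    using c0 by (intro sum.mono_neutral_right) auto
  finally have "norm (of_nat m * of_real W :: complex) = norm (\<Sum>j\<in>{0<..<m}. c j * T j)"
    by (rule arg_cong)
  then have "real m * \<bar>W\<bar> = norm (\<Sum>j\<in>{0<..<m}. c j * T j)"
    by (simp only: norm_mult norm_of_nat norm_of_real)
  also have "\<dots> \<le> (\<Sum>j\<in>{0<..<m}. S * (\<rho> ^ n * E / 2))"
  proof (rule sum_norm_le)
    fix j assume "j \<in> {0<..<m}"
    moreover have "S \<ge> 0" by (simp add: S_def sum_nonneg)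
    ultimately show "norm (c j * T j) \<le> S * (\<rho> ^ n * E / 2)"
      unfolding norm_mult by (intro mult_mono c T) auto
  qed
  also have "\<dots> = (real m - 1) * S * \<rho> ^ n * E / 2" using m0 by (simp add: of_nat_diff)
  finally show ?thesis
    unfolding S_def[symmetric] \<rho>_def[symmetric] E_def[symmetric] W_def[symmetric] using m0 by (simp add: field_simps)
qed

subsection \<open>Protocols and sign rank\<close>

lemma sum_lessThan_add:
  fixes f :: "nat \<Rightarrow> 'a::comm_monoid_add"
  shows "(\<Sum>k<p + q. f k) = (\<Sum>k<p. f k) + (\<Sum>k<q. f (p + k))"
  by (induction q) (auto simp: add.assoc)

text \<open>A rank factorisation with entries bounded by 1, which makes the factors integrable when
  the coins are averaged out.\<close>

definition rank_le :: "nat \<Rightarrow> ('a \<Rightarrow> 'b \<Rightarrow> real) \<Rightarrow> bool" where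
  "rank_le d F \<longleftrightarrow> (\<exists>\<alpha> \<beta>. (\<forall>k a. \<bar>\<alpha> k a\<bar> \<le> 1) \<and> (\<forall>k b. \<bar>\<beta> k b\<bar> \<le> 1) \<and>
     (\<forall>a b. F a b = (\<Sum>k<d. \<alpha> k a * \<beta> k b)))"

text \<open>At a node of a protocol the announced bit masks the two subtrees. Their factorisations
  are put side by side, with the masks absorbed into the factors.\<close>

lemma rank_le_add_masked:
  assumes F: "rank_le p F" and G: "rank_le q G"
    and s: "\<And>a. \<bar>s a\<bar> \<le> 1" "\<And>a. \<bar>s' a\<bar> \<le> 1" and t: "\<And>b. \<bar>t b\<bar> \<le> 1" "\<And>b. \<bar>t' b\<bar> \<le> 1"
  shows "rank_le (p + q) (\<lambda>a b. s a * t b * F a b + s' a * t' b * G a b)"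
proof -
  obtain \<alpha> \<beta> where 1: "\<And>k a. \<bar>\<alpha> k a\<bar> \<le> 1" "\<And>k b. \<bar>\<beta> k b\<bar> \<le> 1" "\<And>a b. F a b = (\<Sum>k<p. \<alpha> k a * \<beta> k b)"
    using F unfolding rank_le_def by metis
  obtain \<alpha>' \<beta>' where 2: "\<And>k a. \<bar>\<alpha>' k a\<bar> \<le> 1" "\<And>k b. \<bar>\<beta>' k b\<bar> \<le> 1" "\<And>a b. G a b = (\<Sum>k<q. \<alpha>' k a * \<beta>' k b)"
    using G unfolding rank_le_def by metis
  show ?thesis
    unfolding rank_le_def
    by (rule exI[of _ "\<lambda>k a. if k < p then s a * \<alpha> k a else s' a * \<alpha>' (k - p) a"],
        rule exI[of _ "\<lambda>k b. if k < p then t b * \<beta> k b else t' b * \<beta>' (k - p) b"])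
      (auto simp: sum_lessThan_add abs_mult 1(3) 2(3) sum_distrib_left mult_ac
        intro!: mult_le_one 1 2 s t)
qed

text \<open>Dimensions add at a node. An upper bound \<open>c\<close> in place of the exact cost
  gives both subtrees the same dimension.\<close>

lemma rank_le_run:
  fixes \<phi> :: "'o \<Rightarrow> real"
  assumes \<phi>: "\<And>z. \<bar>\<phi> z\<bar> \<le> 1"
  shows "cost P \<le> c \<Longrightarrow> rank_le (2 ^ c) (\<lambda>a b. \<phi> (run P a b))"
proof (induction P arbitrary: c)
  case (Output z)
  \<comment> \<open>A constant needs one coordinate; the rest is zero padding.\<close>
  have "(\<Sum>k<(2::nat) ^ c. of_bool (k = 0) * \<phi> z) = (\<Sum>k<(2::nat) ^ c. if k = 0 then \<phi> z else 0)"
    by (intro sum.cong) auto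
  then show ?case
    unfolding rank_le_def using \<phi>
    by (intro exI[of _ "\<lambda>k a. of_bool (k = 0)"] exI[of _ "\<lambda>k b. \<phi> z"]) simp
next
  case (Alice f P Q)
  then obtain c' where c: "c = Suc c'" "cost P \<le> c'" "cost Q \<le> c'" by (cases c) auto
  have "(\<lambda>a b. \<phi> (run (Alice f P Q) a b))
      = (\<lambda>a b. of_bool (f a) * 1 * \<phi> (run P a b) + of_bool (\<not> f a) * 1 * \<phi> (run Q a b))"
    by (intro ext) simp
  then show ?case
    using rank_le_add_masked[OF Alice.IH(1)[OF c(2)] Alice.IH(2)[OF c(3)],
        of "\<lambda>a. of_bool (f a)" "\<lambda>a. of_bool (\<not> f a)" "\<lambda>_. 1" "\<lambda>_. 1"]
    by (simp add: c(1) mult_2)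
next
  case (Bob g P Q)
  then obtain c' where c: "c = Suc c'" "cost P \<le> c'" "cost Q \<le> c'" by (cases c) auto
  have "(\<lambda>a b. \<phi> (run (Bob g P Q) a b))
      = (\<lambda>a b. 1 * of_bool (g b) * \<phi> (run P a b) + 1 * of_bool (\<not> g b) * \<phi> (run Q a b))"
    by (intro ext) simp
  then show ?case
    using rank_le_add_masked[OF Bob.IH(1)[OF c(2)] Bob.IH(2)[OF c(3)],
        of "\<lambda>_. 1" "\<lambda>_. 1" "\<lambda>b. of_bool (g b)" "\<lambda>b. of_bool (\<not> g b)"]
    by (simp add: c(1) mult_2)
qed

section \<open>Averaging over the private coins\<close>

lemma integrable_pmf_bounded:
  fixes f :: "'a \<Rightarrow> real"
  assumes "\<And>x. \<bar>f x\<bar> \<le> B"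
  shows "integrable (measure_pmf p) f"
  using assms by (intro measure_pmf.integrable_const_bound[where B = B]) auto

lemma expectation_pair_pmf_prod:
  fixes f :: "'a \<Rightarrow> real" and g :: "'b \<Rightarrow> real"
  assumes f: "\<And>a. \<bar>f a\<bar> \<le> 1" and g: "\<And>b. \<bar>g b\<bar> \<le> 1"
  shows "measure_pmf.expectation (pair_pmf p q) (\<lambda>(a, b). f a * g b)
    = measure_pmf.expectation p f * measure_pmf.expectation q g"
proof -
  have fg: "\<bar>(case x of (a, b) \<Rightarrow> f a * g b)\<bar> \<le> 1" for x
    using f g by (auto simp: abs_mult intro!: mult_le_one split: prod.split)
  have "measure_pmf.expectation (pair_pmf p q) (\<lambda>(a, b). f a * g b)
      = measure_pmf.expectation p (\<lambda>a. measure_pmf.expectation (map_pmf (Pair a) q) (\<lambda>(a, b). f a * g b))"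
    unfolding pair_pmf_def measure_pmf_bind map_pmf_def[symmetric]
    using measurable_measure_pmf[of "\<lambda>a. map_pmf (Pair a) q"] fg
    by (intro integral_bind[where K = "count_space UNIV" and B = 1 and B' = 1])
      (auto simp: measure_pmf.finite_measure_axioms measure_pmf.emeasure_space_1)
  then show ?thesis by simp
qed

text \<open>Each factor depends on the input and coins of one party, and the coins are independent,
  so averaging keeps the dimension. The averaged output has the sign of \<open>G\<close> because the
  success probability exceeds 1/2.\<close>

lemma computes_with_advantage_sign_rank:
  fixes G :: "'x \<Rightarrow> 'y \<Rightarrow> int"
  assumes comp: "computes_with_advantage X Y G \<epsilon> P \<mu> \<nu>" and \<epsilon>: "\<epsilon> > 0" and cost: "cost P \<le> c"
    and G: "\<And>x y. x \<in> X \<Longrightarrow> y \<in> Y \<Longrightarrow> G x y = 1 \<or> G x y = -1"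
  shows "\<exists>(a :: 'x \<Rightarrow> nat \<Rightarrow> real) (b :: 'y \<Rightarrow> nat \<Rightarrow> real).
    \<forall>x\<in>X. \<forall>y\<in>Y. G x y * (\<Sum>k<2 ^ c. a x k * b y k) > 0"
proof -
  \<comment> \<open>A protocol may output any integer; values other than 1 and -1 are sent to
    0.\<close>
  define \<phi> :: "int \<Rightarrow> real" where "\<phi> z = (if z = 1 then 1 else if z = -1 then -1 else 0)" for z
  have \<phi>: "\<bar>\<phi> z\<bar> \<le> 1" for z by (simp add: \<phi>_def)
  obtain \<alpha> \<beta> where \<alpha>\<beta>: "\<And>k a. \<bar>\<alpha> k a\<bar> \<le> 1" "\<And>k b. \<bar>\<beta> k b\<bar> \<le> 1"
      "\<And>a b. \<phi> (run P a b) = (\<Sum>k<(2::nat) ^ c. \<alpha> k a * \<beta> k b)"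
    using rank_le_run[of \<phi>, OF \<phi> cost] unfolding rank_le_def by blast
  define a where "a x k = measure_pmf.expectation \<mu> (\<lambda>r. \<alpha> k (x, r))" for x k
  define b where "b y k = measure_pmf.expectation \<nu> (\<lambda>s. \<beta> k (y, s))" for y k
  have "G x y * (\<Sum>k<2 ^ c. a x k * b y k) > 0" if x: "x \<in> X" and y: "y \<in> Y" for x y
  proof -
    define S where "S = {(r, s). run P (x, r) (y, s) = G x y}"
    have int: "integrable (pair_pmf \<mu> \<nu>) (\<lambda>(r, s). \<alpha> k (x, r) * \<beta> k (y, s))" for k
      by (rule integrable_pmf_bounded[of _ 1]) (auto simp: abs_mult intro!: mult_le_one \<alpha>\<beta>)
    have "(\<Sum>k<2 ^ c. a x k * b y k) =
        (\<Sum>k<2 ^ c. measure_pmf.expectation (pair_pmf \<mu> \<nu>) (\<lambda>(r, s). \<alpha> k (x, r) * \<beta> k (y, s)))"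
      unfolding a_def b_def by (intro sum.cong refl expectation_pair_pmf_prod[symmetric] \<alpha>\<beta>)
    also have "\<dots> = measure_pmf.expectation (pair_pmf \<mu> \<nu>) (\<lambda>(r, s). \<phi> (run P (x, r) (y, s)))"
      using int by (subst Bochner_Integration.integral_sum[symmetric]) (auto simp: case_prod_unfold \<alpha>\<beta>(3))
    finally have eq: "G x y * (\<Sum>k<2 ^ c. a x k * b y k)
        = measure_pmf.expectation (pair_pmf \<mu> \<nu>) (\<lambda>(r, s). G x y * \<phi> (run P (x, r) (y, s)))"
      by (simp add: case_prod_unfold)
    have "0 < 2 * measure_pmf.prob (pair_pmf \<mu> \<nu>) S - 1"
      using comp x y \<epsilon> unfolding computes_with_advantage_def S_def by fastforce
    also have "\<dots> = measure_pmf.expectation (pair_pmf \<mu> \<nu>) (\<lambda>\<omega>. 2 * indicator S \<omega> - 1)"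
      by (subst Bochner_Integration.integral_diff) (auto simp: less_top[symmetric])
    \<comment> \<open>On \<open>S\<close> both integrands are 1; elsewhere the left one is -1 and
      the right one at least -1.\<close>
    also have "\<dots> \<le> measure_pmf.expectation (pair_pmf \<mu> \<nu>) (\<lambda>(r, s). G x y * \<phi> (run P (x, r) (y, s)))"
      using G[OF x y]
      by (intro integral_mono integrable_pmf_bounded[of _ 3])
        (auto simp: S_def \<phi>_def indicator_def abs_mult split: prod.splits)
    finally show ?thesis unfolding eq .
  qed
  then show ?thesis by blast
qed

subsection \<open>The modular functions\<close>

lemma mod_fun_eq:
  assumes "A \<subseteq> {0..<m}" "0 < m"
  shows "mod_fun m A x = (if hamming x mod m \<in> A then -1 else 1)"
proof -
  have "(\<exists>a\<in>A. [hamming x = a] (mod m)) \<longleftrightarrow> hamming x mod m \<in> A"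
    using assms by (auto simp: cong_def mod_less subset_iff intro: bexI[of _ "hamming x mod m"])
  then show ?thesis by (simp add: mod_fun_def hamming_def)
qed

text \<open>With d = 2^cost and q = 2^n / d, the sign rank bound becomes 2^n \<le> m^2 \<rho>^n d.
  Taking logarithms, the factor m^2 turns into the loss 2 log m.\<close>

lemma cost_mod_xor_ge:
  assumes mn: "odd m" and A: "A \<subseteq> {0..<m}" "A \<noteq> {}" "A \<noteq> {0..<m}" and \<epsilon>: "\<epsilon> > 0"
    and comp: "computes_with_advantage (cube n) (cube n) (compose_xor (mod_fun m A)) \<epsilon> P \<mu> \<nu>"
  shows "real n / (8 * (real m)\<^sup>2) - 2 * log 2 (real m) \<le> real (cost P)"
\<comment> \<open>A cost of at least n satisfies the bound trivially. Otherwise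
  \<open>n - cost P\<close> is a true difference and the blocks fill the cube.\<close>
proof (cases "cost P \<ge> n")
  case True
  have m1: "real m \<ge> 1" using mn by (cases m) auto
  then have "(real m)\<^sup>2 \<ge> 1" by simp
  then have "1 \<le> 8 * (real m)\<^sup>2" by linarith
  then have "real n / (8 * (real m)\<^sup>2) \<le> real n / 1" using m1 by (intro divide_left_mono) auto
  then have "real n / (8 * (real m)\<^sup>2) \<le> real n" by simp
  moreover have "log 2 (real m) \<ge> 0" using m1 by simp
  ultimately show ?thesis using True by linarith
next
  case False
  define d q :: nat where "d = 2 ^ cost P" and "q = 2 ^ (n - cost P)"
  have dq: "q * d = 2 ^ n" "d > 0" "q > 0" using False by (simp_all add: d_def q_def flip: power_add)
  have m0: "m > 0" using mn by (cases m) auto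
  have finA: "finite A" using A(1) finite_subset by blast
  have cardA: "card A > 0" "card A < m"
    using finA A psubset_card_mono[of "{0..<m}" A] by (auto simp: card_gt_0_iff)
  \<comment> \<open>Weighting each class by the size of the other gives mean 0. Both weights are at
    least 1, as \<open>A\<close> is nonempty and proper, so the sign matrix is kept and \<gamma> = 1
    is allowed.\<close>
  define h where "h r = (if r \<in> A then - real (m - card A) else real (card A))" for r
  have split: "(\<Sum>r<m. if r \<in> A then s else t) = card A * s + (m - card A) * t" for s t :: real
  proof -
    have "{..<m} \<inter> {r. r \<in> A} = A" "{..<m} \<inter> - {r. r \<in> A} = {..<m} - A" using A(1) by auto
    then show ?thesis using finA A(1) by (simp add: sum.If_cases card_Diff_subset lessThan_atLeast0)
  qed
  have balanced: "(\<Sum>r<m. h r) = 0" unfolding h_def split by simp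
  have "(\<Sum>r<m. \<bar>h r\<bar>) = (\<Sum>r<m. if r \<in> A then real (m - card A) else real (card A))"
    by (intro sum.cong) (auto simp: h_def)
  also have "\<dots> = 2 * (real (card A) * (real m - real (card A)))"
    unfolding split using cardA by (simp add: of_nat_diff)
  also have "\<dots> \<le> (real m)\<^sup>2 / 2"
    using zero_le_power2[of "real m - 2 * real (card A)"] by (simp add: power2_eq_square algebra_simps)
  finally have abs_sum: "(\<Sum>r<m. \<bar>h r\<bar>) \<le> (real m)\<^sup>2 / 2" .
  define \<rho> where "\<rho> = 2 * exp (- 1 / (8 * (real m)\<^sup>2))"
  define L where "L = (real m - 1) / m * (\<Sum>r<m. \<bar>h r\<bar>) * \<rho> ^ n"
  define M where "M x y = h (hamming (xor_bits x y) mod m)" for x y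
  have G: "compose_xor (mod_fun m A) x y = 1 \<or> compose_xor (mod_fun m A) x y = -1" for x y
    by (simp add: compose_xor_def mod_fun_def)
  obtain a :: "bool list \<Rightarrow> nat \<Rightarrow> real" and b :: "bool list \<Rightarrow> nat \<Rightarrow> real"
    where ab: "\<And>x y. x \<in> cube n \<Longrightarrow> y \<in> cube n \<Longrightarrow>
      of_int (compose_xor (mod_fun m A) x y) * (\<Sum>k<2 ^ cost P. a x k * b y k) > 0"
    using computes_with_advantage_sign_rank[OF comp \<epsilon> order_refl G] by blast
  have "1 * real q \<le> 2 * L"
  proof (rule sign_rank_bound[of q d "cube n" "cube n" 1 "\<lambda>x. vec d (a x)" "\<lambda>y. vec d (b y)" M L])
    fix x y assume x: "x \<in> cube n" and y: "y \<in> cube n"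
    have "vec d (a x) \<bullet> vec d (b y) = (\<Sum>k<d. a x k * b y k)"
      by (simp add: scalar_prod_def lessThan_atLeast0)
    then have pos: "of_int (compose_xor (mod_fun m A) x y) * (vec d (a x) \<bullet> vec d (b y)) > 0"
      using ab[OF x y] by (simp add: d_def)
    have "M x y = (if hamming (xor_bits x y) mod m \<in> A then real (m - card A) else real (card A))
        * of_int (compose_xor (mod_fun m A) x y)"
      by (simp add: M_def h_def compose_xor_def mod_fun_eq[OF A(1) m0])
    then have "M x y * (vec d (a x) \<bullet> vec d (b y))
        = (if hamming (xor_bits x y) mod m \<in> A then real (m - card A) else real (card A))
          * (of_int (compose_xor (mod_fun m A) x y) * (vec d (a x) \<bullet> vec d (b y)))"
      by (simp only: mult.assoc)
    also have "\<dots> > 0" using cardA by (intro mult_pos_pos pos) auto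
    finally show "M x y * (vec d (a x) \<bullet> vec d (b y)) > 0" .
    show "1 \<le> \<bar>M x y\<bar>" using cardA by (auto simp: M_def h_def)
  next
    fix u v :: "bool list \<Rightarrow> real"
    show "(\<Sum>x\<in>cube n. \<Sum>y\<in>cube n. M x y * u x * v y)
        \<le> L * ((\<Sum>x\<in>cube n. (u x)\<^sup>2) + (\<Sum>y\<in>cube n. (v y)\<^sup>2)) / 2"
      using xor_mod_form_le[OF mn balanced, where n = n and u = u and v = v] unfolding M_def L_def \<rho>_def by linarith
  qed (simp_all add: dq card_cube)
  then have q_le: "real q \<le> 2 * L" by simp
  have "2 * L \<le> 2 * (1 * ((real m)\<^sup>2 / 2) * \<rho> ^ n)"
    unfolding L_def using m0 abs_sum
    by (intro mult_left_mono mult_right_mono mult_mono) (auto simp: \<rho>_def sum_nonneg)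
  with q_le have "real q * real d \<le> ((real m)\<^sup>2 * \<rho> ^ n) * real d"
    by (intro mult_right_mono) auto
  moreover have "real q * real d = 2 ^ n" using dq(1) by (metis of_nat_mult of_nat_numeral of_nat_power)
  moreover have "\<rho> ^ n = 2 ^ n * exp (- (real n / (8 * (real m)\<^sup>2)))"
    by (simp add: \<rho>_def power_mult_distrib flip: exp_of_nat_mult)
  ultimately have "2 ^ n * 1 \<le> 2 ^ n * ((real m)\<^sup>2 * exp (- (real n / (8 * (real m)\<^sup>2))) * real d)"
    by (simp only: mult_ac mult_1_right)
  then have "1 \<le> (real m)\<^sup>2 * exp (- (real n / (8 * (real m)\<^sup>2))) * real d"
    by (simp only: mult_le_cancel_left_pos zero_less_power zero_less_numeral)
  then have "exp (real n / (8 * (real m)\<^sup>2)) \<le> (real m)\<^sup>2 * real d"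
    by (simp add: exp_minus field_simps)
  then have "real n / (8 * (real m)\<^sup>2) \<le> ln ((real m)\<^sup>2 * real d)"
    using m0 dq by (subst ln_ge_iff) auto
  also have "\<dots> = 2 * ln (real m) + real (cost P) * ln 2"
    using m0 by (simp add: ln_mult ln_realpow d_def)
  finally have "real n / (8 * (real m)\<^sup>2) \<le> (2 * log 2 (real m) + real (cost P)) * ln 2"
    by (simp add: log_def algebra_simps)
  also have "\<dots> \<le> (2 * log 2 (real m) + real (cost P)) * 1"
    using m0 ln_2_less_1 by (intro mult_left_mono) (auto intro!: add_nonneg_nonneg)
  finally show ?thesis by simp
qed

theorem mainTheorem9:
  "\<exists>c>0::real. \<forall>(n::nat) (m::nat) (A::nat set).
     0 < m \<and> m < n \<and> odd m \<and> A \<subseteq> {0..<m} \<and> A \<noteq> {} \<and> A \<noteq> {0..<m} \<longrightarrow>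
     ereal_of_enat (UPP (cube n) (cube n) (compose_xor (mod_fun m A)))
       \<ge> ereal (c * real n / (real m)\<^sup>2 - 2 * log 2 (real m))"
proof (intro exI[of _ "1 / 8"] conjI allI impI)
  fix n m :: nat and A :: "nat set"
  assume *: "0 < m \<and> m < n \<and> odd m \<and> A \<subseteq> {0..<m} \<and> A \<noteq> {} \<and> A \<noteq> {0..<m}"
  define r where "r = 1 / 8 * real n / (real m)\<^sup>2 - 2 * log 2 (real m)"
  \<comment> \<open>The infimum lives in the extended naturals, so \<open>r\<close> is rounded up
    first; a negative \<open>r\<close> becomes 0, which is still at least \<open>r\<close>.\<close>
  have "enat (nat \<lceil>r\<rceil>) \<le> UPP (cube n) (cube n) (compose_xor (mod_fun m A))"
    unfolding UPP_def rand_cc_def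
  proof (intro INF_greatest Inf_greatest)
    fix \<epsilon> :: real and e
    assume "\<epsilon> \<in> {0<..}" and "e \<in> {enat (cost P) |P \<mu> \<nu>.
      computes_with_advantage (cube n) (cube n) (compose_xor (mod_fun m A)) \<epsilon> P \<mu> \<nu>}"
    then obtain P \<mu> \<nu> where e: "e = enat (cost P)" and "\<epsilon> > 0"
      and "computes_with_advantage (cube n) (cube n) (compose_xor (mod_fun m A)) \<epsilon> P \<mu> \<nu>"
      by auto
    then have "r \<le> real (cost P)"
      using cost_mod_xor_ge[of m A \<epsilon> n P \<mu> \<nu>] * by (simp add: r_def)
    then show "enat (nat \<lceil>r\<rceil>) \<le> e" by (simp add: e nat_le_iff ceiling_le_iff)
  qed
  then have "ereal_of_enat (enat (nat \<lceil>r\<rceil>))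
      \<le> ereal_of_enat (UPP (cube n) (cube n) (compose_xor (mod_fun m A)))"
    by (simp only: ereal_of_enat_le_iff)
  moreover have "ereal r \<le> ereal_of_enat (enat (nat \<lceil>r\<rceil>))" by (simp add: real_nat_ceiling_ge)
  ultimately show "ereal (1 / 8 * real n / (real m)\<^sup>2 - 2 * log 2 (real m))
      \<le> ereal_of_enat (UPP (cube n) (cube n) (compose_xor (mod_fun m A)))"
    unfolding r_def using order_trans by blast
qed simp

end
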